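(* Let $\alpha>1$, $L>0$, and let $p\in\Sigma(L,\alpha)$ be a probability density on $\mathbb{R}^d$ with compact and connected support and finitely many split levels. Suppose that conditions (C) and (S($\alpha$)) hold for $p$. Let $X_1,\dots,X_n$ be i.i.d. from $p$, let $K$ be an $\alpha$-valid kernel, and let $h\asymp\left(\frac{\log n}{n}\right)^{1/(2\alpha+d)}$. Then, with probability at least $1-\frac1n-O\left(h^{-d}\exp(-c\,n^{\alpha/(2\alpha+d)})\right)$, the cluster tree returned by the modified DBSCAN algorithm with inputs $\{X_i\}_{i=1}^n$, $K$, $h$ is $\delta$-consistent with rate $$\delta_n\ \ge\ 2a_n+\left(\frac{4h}{c_S}\right)^{\alpha},$$ where $c$ is a constant that depends on $p$ only, $$a_n = C_1\sqrt{\frac{\log n+\log(1/h)}{nh^d}}+C_2h^\alpha ,$$ and $c_S$ is the constant in condition (S($\alpha$)).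
   Context: Notation: $B(x,r)$ is the closed Euclidean ball, $\mathcal{L}$ is Lebesgue measure on $\mathbb{R}^d$, $V_d=\mathcal{L}(B(0,1))$, $d(A,B)=\inf_{x\in A,y\in B}\|x-y\|$; $a_n\asymp b_n$ means the ratio is bounded above and below by positive constants. Hölder class: $\lfloor\alpha\rfloor$ denotes the largest integer strictly smaller than $\alpha$. $\Sigma(L,\alpha)$ is the set of functions $p:\mathbb{R}^d\to\mathbb{R}$ that are $\lfloor\alpha\rfloor$-times continuously differentiable with $|D^sp(x)-D^sp(y)|\le L\|x-y\|^{\alpha-|s|}$ for all $x,y\in\mathbb{R}^d$ and all multi-indices $s\in\mathbb{N}^d$ with $|s|=\lfloor\alpha\rfloor$. $\alpha$-valid kernel: $K:\mathbb{R}^d\to\mathbb{R}$ with $\int K=1$, finite $L_p$ norm for all $p\ge1$, $\int\|x\|^\alpha K(x)dx<\infty$, and $\int x^sK(x)dx=0$ for all multi-indices $s$ with $1\le|s|\le\lfloor\alpha\rfloor$. Kernels are assumed bounded, with bounded support, and to satisfy the VC condition: the class $\mathcal{F}=\{z\mapsto K(x-z):x\in\mathbb{R}^d\}$, with envelope $F$, is uniformly bounded and there are $A,v>0$ with $\sup_P\mathcal{N}(\mathcal{F},L^2(P),\epsilon\|F\|_{L^2(P)})\le(A/\epsilon)^v$ for the $\epsilon$-covering numbers, the sup being over all probability measures $P$ on $\mathbb{R}^d$. Kernel density estimator: $\widehat p_h(x)=\frac{1}{nh^d}\sum_{i=1}^nK\left(\frac{x-X_i}{h}\right)$. $C_1$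 (depending on $\|p\|_\infty,d,K$) and $C_2$ (depending on $L$ and $\alpha$, for the given kernel) are constants such that for every $\gamma>0$ and all $n$ large enough with $nh^d\ge1$, $\|\widehat p_h-p\|_\infty\le C_1\sqrt{\frac{\gamma+\log(1/h)}{nh^d}}+C_2h^\alpha$ with probability at least $1-e^{-\gamma}$; $a_n$ is this bound with $\gamma=\log n$. Cluster tree estimator: a collection $\widehat T_n$, indexed by levels in $[0,\infty)$, such that each $\widehat T_n(\lambda)$ consists of disjoint subsets of $\{X_i\}_{i=1}^n$ (clusters), and for $\lambda_1\ge\lambda_2\ge 0$, $A\in\widehat T_n(\lambda_1)$, $B\in\widehat T_n(\lambda_2)$, either $A\cap B=\emptyset$ or $A\subseteq B$. Modified DBSCAN algorithm: for each $\lambda\ge0$ form the graph $\mathbb{G}_{h,\lambda}$ with node set $\widehat D(\lambda)=\{X_i:\widehat p_h(X_i)\ge\lambda\}$ and an edge between $X_i,X_j\in\widehat D(\lambda)$ iff $\|X_i-X_j\|<2h$; let $\mathbb{C}(h,\lambda)$ be the collection of its connected components. The output is the cluster tree estimator $\{\mathbb{C}(h,\lambda):\lambda\ge0\}$. $\delta$-separation: for subsets $A,A'$ of the support of $p$ put $\lambda=\inf_{x\in A\cup A'}p(x)$; for $\delta\in(0,\lambda)$, $A$ and $A'$ are $\delta$-separated if they belong to distinct connected components of $\{x:p(x)>\lambda-\delta\}$. $(\delta,\gamma)$-accuracy: a cluster tree estimator is $(\delta,\gamma)$-accurate if, with probability at least $1-\gamma$, simultaneously for every pair of connected subsets $A,A'$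 of the support of $p$ that are $\delta$-separated, exactly one of the following holds: (1) at least one of $A\cap\{X_i\}_{i=1}^n$, $A'\cap\{X_i\}_{i=1}^n$ is empty; (2) the smallest clusters of the estimator containing $A\cap\{X_i\}_{i=1}^n$ and $A'\cap\{X_i\}_{i=1}^n$ are disjoint. A sequence of estimators is $\delta$-consistent with rate $\delta_n$ (a vanishing sequence of positive numbers) if for all $n$ large enough it is $(\delta_n,\gamma_n)$-accurate with $\gamma_n$ vanishing and decaying polynomially in $n$. The probability in the claim plays the role of $1-\gamma_n$. Split level: $\lambda^*>0$ is a split level of the continuous density $p$ if some connected component $\mathcal{C}$ of $\{p\ge\lambda^*\}$ is such that $\mathcal{C}\cap\{p>\lambda^*\}$ has two or more connected components. A set $\Omega\subset\mathbb{R}^d$ satisfies (C1) with constants $r_I,c_I>0$ if $\mathcal{L}(B(x,r)\cap\Omega)\ge c_IV_dr^d$ for all $0\le r\le r_I$, $x\in\Omega$; it satisfies (C2) with constant $C_I$ if for every $0<r\le r_I$ there is $\mathcal{N}_r\subset\Omega$ with $\mathrm{card}(\mathcal{N}_r)\le C_Ir^{-d}$ and $\bigcup_{y\in\mathcal{N}_r}B(y,r)\supset\Omega$. Condition (C): there is $\delta_0>0$ such that for any split level $\lambda^*$ of $p$ and any $0<\delta\le\delta_0$, the set $\{p\ge\lambda^*+\delta\}$ satisfies (C1) and (C2) with constants $r_I,c_I,C_I$ depending only on $p$. Condition (S($\alpha$)): there are $\delta_S,c_S>0$ such that for each split level $\lambda^*$ of $p$, with $\{\mathcal{C}_k\}_{k=1}^K$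 the connected components of $\{p>\lambda^*\}$, $\min_{k\ne k'}d\left(\mathcal{C}_k\cap\{p\ge\lambda^*+\delta\},\mathcal{C}_{k'}\cap\{p\ge\lambda^*+\delta\}\right)\ge c_S\delta^{1/\alpha}$ for all $\delta\in(0,\delta_S]$.
   Formalization: "Connected support" is strengthened to connectedness of {p>0} (the closed support being compact): with only the closed support connected, two bumps touching at a zero of p, which have no split level, give a counterexample. *)

theory Defs
  imports "HOL-Probability.Probability" "HOL-Library.Landau_Symbols"
begin

text \<open>
  A multi-index is a function \<open>s :: 'a \<Rightarrow> nat\<close> of which only the values on \<open>Basis\<close> matter.
\<close>

definition mi_order :: "('a::euclidean_space \<Rightarrow> nat) \<Rightarrow> nat" where
  "mi_order s = (\<Sum>b\<in>Basis. s b)"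

definition mi_power :: "'a::euclidean_space \<Rightarrow> ('a \<Rightarrow> nat) \<Rightarrow> real" where
  "mi_power x s = (\<Prod>b\<in>Basis. (x \<bullet> b) ^ s b)"

definition partial :: "'a::euclidean_space \<Rightarrow> ('a \<Rightarrow> real) \<Rightarrow> 'a \<Rightarrow> real" where
  "partial b f x = deriv (\<lambda>t. f (x + t *\<^sub>R b)) 0"

text \<open>
  \<open>Basis\<close> is an unordered set. The order chosen here for the coordinates does not matter for the
  mixed partial derivatives of order at most \<open>k\<close> of a \<open>k\<close>-times continuously differentiable function.
\<close>

definition basis_list :: "'a::euclidean_space list" where
  "basis_list = (SOME bs. distinct bs \<and> set bs = Basis)"

definition mi_deriv :: "('a::euclidean_space \<Rightarrow> nat) \<Rightarrow> ('a \<Rightarrow> real) \<Rightarrow> 'a \<Rightarrow> real" where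
  "mi_deriv s f = foldr (\<lambda>b. partial b ^^ s b) basis_list f"

primrec cont_diff :: "nat \<Rightarrow> ('a::euclidean_space \<Rightarrow> real) \<Rightarrow> bool" where
  "cont_diff 0 f \<longleftrightarrow> continuous_on UNIV f"
| "cont_diff (Suc k) f \<longleftrightarrow> (\<forall>x. f differentiable (at x)) \<and> (\<forall>b\<in>Basis. cont_diff k (partial b f))"

text \<open>The largest integer strictly smaller than \<open>\<alpha>\<close>, for \<open>\<alpha> > 0\<close>; so it is 1 for \<open>\<alpha> = 2\<close>.\<close>

definition strict_floor :: "real \<Rightarrow> nat" where
  "strict_floor \<alpha> = (GREATEST k. real k < \<alpha>)"

definition hoelder_class :: "real \<Rightarrow> real \<Rightarrow> ('a::euclidean_space \<Rightarrow> real) set" where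
  "hoelder_class L \<alpha> = {f. cont_diff (strict_floor \<alpha>) f \<and>
     (\<forall>s. mi_order s = strict_floor \<alpha> \<longrightarrow>
       (\<forall>x y. \<bar>mi_deriv s f x - mi_deriv s f y\<bar> \<le> L * norm (x - y) powr (\<alpha> - real (mi_order s))))}"

definition valid_kernel :: "real \<Rightarrow> ('a::euclidean_space \<Rightarrow> real) \<Rightarrow> bool" where
  "valid_kernel \<alpha> K \<longleftrightarrow>
     K \<in> borel_measurable borel \<and>
     has_bochner_integral lborel K 1 \<and>
     (\<forall>q\<ge>1. integrable lborel (\<lambda>x. \<bar>K x\<bar> powr q)) \<and>
     integrable lborel (\<lambda>x. norm x powr \<alpha> * K x) \<and>
     (\<forall>s. 1 \<le> mi_order s \<and> mi_order s \<le> strict_floor \<alpha> \<longrightarrow>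
        has_bochner_integral lborel (\<lambda>x. mi_power x s * K x) 0)"

definition L2_norm :: "'a measure \<Rightarrow> ('a \<Rightarrow> real) \<Rightarrow> real" where
  "L2_norm P f = sqrt (\<integral>z. (f z)\<^sup>2 \<partial>P)"

text \<open>
  Centres are taken in the class itself; the value is \<open>\<infinity>\<close> if there is no finite cover.
\<close>

definition covering_number :: "('a \<Rightarrow> real) set \<Rightarrow> 'a measure \<Rightarrow> real \<Rightarrow> ereal" where
  "covering_number \<F> P \<epsilon> =
     (INF S \<in> {S. finite S \<and> S \<subseteq> \<F> \<and> (\<forall>f\<in>\<F>. \<exists>g\<in>S. L2_norm P (\<lambda>z. f z - g z) \<le> \<epsilon>)}.
        ereal (real (card S)))"

text \<open>
  The radius is restricted to \<open>0 < \<epsilon> < 1\<close>: covering numbers of a nonempty class are at least 1,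
  whereas \<open>(A / \<epsilon>) powr v\<close> tends to 0 as \<open>\<epsilon>\<close> grows.
\<close>

definition vc_kernel :: "('a::euclidean_space \<Rightarrow> real) \<Rightarrow> bool" where
  "vc_kernel K \<longleftrightarrow>
     (let \<F> = range (\<lambda>x z. K (x - z)) in
      \<exists>F A v. F \<in> borel_measurable borel \<and> bounded (range F) \<and>
        (\<forall>f\<in>\<F>. \<forall>z. \<bar>f z\<bar> \<le> F z) \<and> 0 < A \<and> 0 < v \<and>
        (\<forall>\<epsilon>. 0 < \<epsilon> \<and> \<epsilon> < 1 \<longrightarrow>
          (SUP P \<in> {P. prob_space P \<and> sets P = sets borel}. covering_number \<F> P (\<epsilon> * L2_norm P F))
            \<le> ereal ((A / \<epsilon>) powr v)))"

definition prob_density :: "('a::euclidean_space \<Rightarrow> real) \<Rightarrow> bool" where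
  "prob_density p \<longleftrightarrow> p \<in> borel_measurable borel \<and> (\<forall>x. 0 \<le> p x) \<and> has_bochner_integral lborel p 1"

definition density_support :: "('a::euclidean_space \<Rightarrow> real) \<Rightarrow> 'a set" where
  "density_support p = closure {x. 0 < p x}"

text \<open>
  Connectedness of the support is required of \<open>{x. 0 < p x}\<close>; this implies connectedness of the
  closure but not conversely. If \<open>p\<close> consists of two unimodal bumps that touch in a single zero of
  \<open>p\<close>, then the closure is connected, yet the bumps separate at level 0 only, which is not a split
  level (split levels are positive), and no condition on \<open>p\<close> at split levels constrains them.
\<close>

definition compact_connected_support :: "('a::euclidean_space \<Rightarrow> real) \<Rightarrow> bool" where
  "compact_connected_support p \<longleftrightarrow> compact (density_support p) \<and> connected {x. 0 < p x}"

definition split_level :: "('a::euclidean_space \<Rightarrow> real) \<Rightarrow> real \<Rightarrow> bool" where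
  "split_level p l \<longleftrightarrow> 0 < l \<and>
     (\<exists>C \<in> components {x. l \<le> p x}.
        \<exists>D \<in> components (C \<inter> {x. l < p x}). \<exists>D' \<in> components (C \<inter> {x. l < p x}). D \<noteq> D')"

definition inner_regular_set :: "real \<Rightarrow> real \<Rightarrow> 'a::euclidean_space set \<Rightarrow> bool" where
  "inner_regular_set r\<^sub>I c\<^sub>I \<Omega> \<longleftrightarrow> (\<forall>r x. 0 \<le> r \<and> r \<le> r\<^sub>I \<and> x \<in> \<Omega> \<longrightarrow>
     c\<^sub>I * measure lebesgue (cball (0::'a) 1) * r ^ DIM('a) \<le> measure lebesgue (cball x r \<inter> \<Omega>))"

definition coverable_set :: "real \<Rightarrow> real \<Rightarrow> 'a::euclidean_space set \<Rightarrow> bool" where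
  "coverable_set r\<^sub>I C\<^sub>I \<Omega> \<longleftrightarrow> (\<forall>r. 0 < r \<and> r \<le> r\<^sub>I \<longrightarrow>
     (\<exists>N \<subseteq> \<Omega>. finite N \<and> real (card N) \<le> C\<^sub>I * r powr (- real DIM('a)) \<and> \<Omega> \<subseteq> (\<Union>y\<in>N. cball y r)))"

definition condition_C :: "('a::euclidean_space \<Rightarrow> real) \<Rightarrow> bool" where
  "condition_C p \<longleftrightarrow> (\<exists>\<delta>\<^sub>0>0. \<exists>r\<^sub>I>0. \<exists>c\<^sub>I>0. \<exists>C\<^sub>I>0. \<forall>l \<delta>. split_level p l \<and> 0 < \<delta> \<and> \<delta> \<le> \<delta>\<^sub>0 \<longrightarrow>
     inner_regular_set r\<^sub>I c\<^sub>I {x. l + \<delta> \<le> p x} \<and> coverable_set r\<^sub>I C\<^sub>I {x. l + \<delta> \<le> p x})"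

text \<open>
  Unlike \<^const>\<open>setdist\<close>, which is 0 if one of the sets is empty, this is \<open>\<infinity>\<close> in that case.
\<close>

definition set_distance :: "'a::metric_space set \<Rightarrow> 'a set \<Rightarrow> ereal" where
  "set_distance A B = (INF x\<in>A. INF y\<in>B. ereal (dist x y))"

definition condition_S :: "('a::euclidean_space \<Rightarrow> real) \<Rightarrow> real \<Rightarrow> real \<Rightarrow> bool" where
  "condition_S p \<alpha> c\<^sub>S \<longleftrightarrow> 0 < c\<^sub>S \<and> (\<exists>\<delta>\<^sub>S>0. \<forall>l. split_level p l \<longrightarrow>
     (\<forall>\<delta>. 0 < \<delta> \<and> \<delta> \<le> \<delta>\<^sub>S \<longrightarrow>
       (\<forall>C \<in> components {x. l < p x}. \<forall>C' \<in> components {x. l < p x}. C \<noteq> C' \<longrightarrow>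
          ereal (c\<^sub>S * \<delta> powr (1 / \<alpha>))
            \<le> set_distance (C \<inter> {x. l + \<delta> \<le> p x}) (C' \<inter> {x. l + \<delta> \<le> p x}))))"

text \<open>
  The sample \<open>X\<^sub>1, \<dots>, X\<^sub>n\<close> is represented by \<open>x 0, \<dots>, x (n - 1)\<close>.
\<close>

definition iid_from_density ::
  "'w measure \<Rightarrow> (nat \<Rightarrow> 'w \<Rightarrow> 'a::euclidean_space) \<Rightarrow> ('a \<Rightarrow> real) \<Rightarrow> bool" where
  "iid_from_density M X p \<longleftrightarrow> prob_space M \<and> prob_space.indep_vars M (\<lambda>_. borel) X UNIV \<and>
     (\<forall>i. distributed M lborel (X i) (\<lambda>x. ennreal (p x)))"

text \<open>
  ``With probability at least \<open>q\<close>'' without asserting measurability of the event itself, which is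
  an uncountable intersection in the uses below.
\<close>

definition prob_at_least :: "'w measure \<Rightarrow> real \<Rightarrow> ('w \<Rightarrow> bool) \<Rightarrow> bool" where
  "prob_at_least M q Q \<longleftrightarrow> (\<exists>E \<in> sets M. (\<forall>\<omega>\<in>E. Q \<omega>) \<and> q \<le> measure M E)"

definition sample_points :: "nat \<Rightarrow> (nat \<Rightarrow> 'a) \<Rightarrow> 'a set" where
  "sample_points n x = x ` {..<n}"

definition kde ::
  "('a::euclidean_space \<Rightarrow> real) \<Rightarrow> real \<Rightarrow> nat \<Rightarrow> (nat \<Rightarrow> 'a) \<Rightarrow> 'a \<Rightarrow> real" where
  "kde K h n x y = 1 / (real n * h ^ DIM('a)) * (\<Sum>i<n. K ((y - x i) /\<^sub>R h))"

definition sup_norm :: "('a \<Rightarrow> real) \<Rightarrow> ereal" where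
  "sup_norm f = (SUP x. ereal \<bar>f x\<bar>)"

definition kde_bound :: "nat \<Rightarrow> real \<Rightarrow> real \<Rightarrow> real \<Rightarrow> nat \<Rightarrow> real \<Rightarrow> real \<Rightarrow> real" where
  "kde_bound d \<alpha> C\<^sub>1 C\<^sub>2 n h \<gamma> =
     C\<^sub>1 * sqrt ((\<gamma> + ln (1 / h)) / (real n * h ^ d)) + C\<^sub>2 * h powr \<alpha>"

text \<open>
  The defining property of the constants \<open>C\<^sub>1, C\<^sub>2\<close> along a bandwidth sequence \<open>h\<close>. The bound has
  to be applicable with \<open>\<gamma> = ln n\<close>, so the threshold for \<open>n\<close> cannot depend on \<open>\<gamma>\<close>; it is uniform
  over \<open>0 < \<gamma> \<le> ln n\<close>, which covers every fixed \<open>\<gamma> > 0\<close> for large \<open>n\<close>. It is not uniform over all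
  \<open>\<gamma> > 0\<close>: for \<open>\<gamma>\<close> much larger than \<open>n h\<^sup>d\<close> the bound fails for any choice of constants.
\<close>

definition kde_constants ::
  "'w measure \<Rightarrow> (nat \<Rightarrow> 'w \<Rightarrow> 'a::euclidean_space) \<Rightarrow> ('a \<Rightarrow> real) \<Rightarrow> ('a \<Rightarrow> real) \<Rightarrow>
     (nat \<Rightarrow> real) \<Rightarrow> real \<Rightarrow> real \<Rightarrow> real \<Rightarrow> bool" where
  "kde_constants M X p K h \<alpha> C\<^sub>1 C\<^sub>2 \<longleftrightarrow>
     (\<forall>\<^sub>F n in sequentially. 1 \<le> real n * h n ^ DIM('a) \<longrightarrow>
        (\<forall>\<gamma>. 0 < \<gamma> \<and> \<gamma> \<le> ln (real n) \<longrightarrow>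
           prob_at_least M (1 - exp (- \<gamma>))
             (\<lambda>\<omega>. sup_norm (\<lambda>y. kde K (h n) n (\<lambda>i. X i \<omega>) y - p y)
                    \<le> ereal (kde_bound DIM('a) \<alpha> C\<^sub>1 C\<^sub>2 n (h n) \<gamma>))))"

definition cluster_tree :: "'a set \<Rightarrow> (real \<Rightarrow> 'a set set) \<Rightarrow> bool" where
  "cluster_tree S T \<longleftrightarrow>
     (\<forall>l\<ge>0. (\<forall>A\<in>T l. A \<subseteq> S) \<and> (\<forall>A\<in>T l. \<forall>B\<in>T l. A \<noteq> B \<longrightarrow> A \<inter> B = {})) \<and>
     (\<forall>l\<^sub>1 l\<^sub>2. 0 \<le> l\<^sub>2 \<and> l\<^sub>2 \<le> l\<^sub>1 \<longrightarrow> (\<forall>A\<in>T l\<^sub>1. \<forall>B\<in>T l\<^sub>2. A \<inter> B = {} \<or> A \<subseteq> B))"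

definition dbscan_nodes ::
  "('a::euclidean_space \<Rightarrow> real) \<Rightarrow> real \<Rightarrow> nat \<Rightarrow> (nat \<Rightarrow> 'a) \<Rightarrow> real \<Rightarrow> 'a set" where
  "dbscan_nodes K h n x l = {z \<in> sample_points n x. l \<le> kde K h n x z}"

definition dbscan_edges ::
  "('a::euclidean_space \<Rightarrow> real) \<Rightarrow> real \<Rightarrow> nat \<Rightarrow> (nat \<Rightarrow> 'a) \<Rightarrow> real \<Rightarrow> ('a \<times> 'a) set" where
  "dbscan_edges K h n x l =
     {(y, z). y \<in> dbscan_nodes K h n x l \<and> z \<in> dbscan_nodes K h n x l \<and> norm (y - z) < 2 * h}"

definition dbscan ::
  "('a::euclidean_space \<Rightarrow> real) \<Rightarrow> real \<Rightarrow> nat \<Rightarrow> (nat \<Rightarrow> 'a) \<Rightarrow> real \<Rightarrow> 'a set set" where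
  "dbscan K h n x l = dbscan_nodes K h n x l // (dbscan_edges K h n x l)\<^sup>*"

definition delta_separated ::
  "('a::euclidean_space \<Rightarrow> real) \<Rightarrow> real \<Rightarrow> 'a set \<Rightarrow> 'a set \<Rightarrow> bool" where
  "delta_separated p \<delta> A A' \<longleftrightarrow>
     (let l = Inf (p ` (A \<union> A')) in 0 < \<delta> \<and> \<delta> < l \<and>
       (\<exists>C \<in> components {x. l - \<delta> < p x}. \<exists>C' \<in> components {x. l - \<delta> < p x}.
          C \<noteq> C' \<and> A \<subseteq> C \<and> A' \<subseteq> C'))"

text \<open>
  The smallest cluster is the least one with respect to inclusion, among the clusters of all levels.
\<close>

definition smallest_cluster :: "(real \<Rightarrow> 'a set set) \<Rightarrow> 'a set \<Rightarrow> 'a set \<Rightarrow> bool" where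
  "smallest_cluster T S C \<longleftrightarrow> C \<in> (\<Union>l\<in>{0..}. T l) \<and> S \<subseteq> C \<and>
     (\<forall>B \<in> (\<Union>l\<in>{0..}. T l). S \<subseteq> B \<longrightarrow> C \<subseteq> B)"

definition smallest_clusters_disjoint :: "(real \<Rightarrow> 'a set set) \<Rightarrow> 'a set \<Rightarrow> 'a set \<Rightarrow> bool" where
  "smallest_clusters_disjoint T S S' \<longleftrightarrow>
     (\<exists>C C'. smallest_cluster T S C \<and> smallest_cluster T S' C' \<and> C \<inter> C' = {})"

text \<open>
  An estimator for sample size \<open>n\<close> is a function \<open>T\<close> of the sample. The inequality \<open>\<noteq>\<close> between
  truth values is the exclusive ``or''.
\<close>

definition accurate ::
  "'w measure \<Rightarrow> (nat \<Rightarrow> 'w \<Rightarrow> 'a::euclidean_space) \<Rightarrow> ('a \<Rightarrow> real) \<Rightarrow> nat \<Rightarrow>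
     ((nat \<Rightarrow> 'a) \<Rightarrow> real \<Rightarrow> 'a set set) \<Rightarrow> real \<Rightarrow> real \<Rightarrow> bool" where
  "accurate M X p n T \<delta> \<gamma> \<longleftrightarrow>
     (\<forall>x. cluster_tree (sample_points n x) (T x)) \<and>
     prob_at_least M (1 - \<gamma>) (\<lambda>\<omega>.
       let x = (\<lambda>i. X i \<omega>); S = sample_points n x in
       \<forall>A A'. A \<subseteq> density_support p \<and> A' \<subseteq> density_support p \<and> connected A \<and> connected A' \<and>
         delta_separated p \<delta> A A' \<longrightarrow>
         (A \<inter> S = {} \<or> A' \<inter> S = {}) \<noteq> smallest_clusters_disjoint (T x) (A \<inter> S) (A' \<inter> S))"

definition delta_consistent ::
  "'w measure \<Rightarrow> (nat \<Rightarrow> 'w \<Rightarrow> 'a::euclidean_space) \<Rightarrow> ('a \<Rightarrow> real) \<Rightarrow>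
     (nat \<Rightarrow> (nat \<Rightarrow> 'a) \<Rightarrow> real \<Rightarrow> 'a set set) \<Rightarrow> (nat \<Rightarrow> real) \<Rightarrow> (nat \<Rightarrow> real) \<Rightarrow> bool" where
  "delta_consistent M X p T \<delta> \<gamma> \<longleftrightarrow>
     (\<forall>n. 0 < \<delta> n) \<and> \<delta> \<longlonglongrightarrow> 0 \<and>
     \<gamma> \<longlonglongrightarrow> 0 \<and> (\<exists>k>0. \<gamma> \<in> O(\<lambda>n. real n powr (- k))) \<and>
     (\<forall>\<^sub>F n in sequentially. accurate M X p n (T n) (\<delta> n) (\<gamma> n))"

end

theory Submission
  imports Defs "HOL-Real_Asymp.Real_Asymp"
begin

text \<open>
  Write \<open>a\<close> for the bound on \<open>\<bar>kde - p\<bar>\<close>, \<open>t = (4 h / c\<^sub>S) powr \<alpha>\<close> and \<open>\<epsilon> = 2 a + t\<close>, and let \<open>A, A'\<close> be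
  \<open>\<delta>\<close>-separated with \<open>\<epsilon> \<le> \<delta>\<close>. Since \<open>{x. 0 < p x}\<close> is connected, lowering the level eventually merges
  the components of \<open>A\<close> and \<open>A'\<close>, and the level \<open>s\<close> at which this happens is a split level
  (\<open>split_level_between\<close>). Both sets lie in \<open>{x. s + \<delta> \<le> p x}\<close>. The graph of level \<open>s + a + t\<close> then does
  what is wanted:

  \<^item> its nodes satisfy \<open>s + t \<le> p x\<close>, where by condition S different components of \<open>{x. s < p x}\<close> are
    at distance at least \<open>4 h\<close> for small \<open>h\<close>, so that no edge joins two of them;
  \<^item> it contains every sample point with \<open>s + \<epsilon> \<le> p x\<close>. If these are \<open>h / 2\<close>-dense in
    \<open>{x. s + \<epsilon> \<le> p x}\<close>, all sample points of a connected subset of that set, such as \<open>A\<close> or \<open>A'\<close>, are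
    joined by paths (\<open>dbscan_connects\<close>).

  So \<open>A\<close> and \<open>A'\<close> have disjoint clusters at this level; the smallest clusters are contained in them
  (\<open>dbscan_resolves_separated_sets\<close>).

  The key to the probability bound is that \<open>\<epsilon>\<close> is not random and depends neither on \<open>A\<close>
  nor on \<open>A'\<close>. As there are finitely many split levels, density is needed in finitely many superlevel
  sets only, and it follows from condition C by a union bound over the balls of radius \<open>h / 4\<close> of a
  cover (\<open>prob_sample_dense_in_superlevel_sets\<close>). The part of such a ball in its superlevel
  set is missed with probability at most \<open>exp (- \<kappa> n h\<^sup>d)\<close>, where \<open>\<kappa> > 0\<close> depends on \<open>p\<close>. Because
  \<open>n h\<^sup>d\<close> is at least of the order of the square of
  \<open>n powr (\<alpha> / (2 \<alpha> + d))\<close>, this is eventually below \<open>exp (- n powr (\<alpha> / (2 \<alpha> + d)))\<close> for every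
  \<open>\<kappa> > 0\<close>, so that the constant \<open>c\<close> of the theorem can be 1.
\<close>

section \<open>Superlevel sets and split levels\<close>

lemma hoelder_class_continuous:
  assumes "f \<in> hoelder_class L \<alpha>"
  shows "continuous_on UNIV f"
  using assms unfolding hoelder_class_def
  by (cases "strict_floor \<alpha>")
    (auto intro!: continuous_at_imp_continuous_on differentiable_imp_continuous_within)

lemma compact_superlevel:
  fixes p :: "'a::euclidean_space \<Rightarrow> real"
  assumes "continuous_on UNIV p" "compact (density_support p)" "0 < t"
  shows "compact {x. t \<le> p x}"
proof -
  have "closed {x. t \<le> p x}"
    using assms(1) by (intro closed_Collect_le) auto
  moreover have "{x. t \<le> p x} \<subseteq> density_support p"
    unfolding density_support_def using assms(3) closure_subset[of "{x. 0 < p x}"] by force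
  ultimately show ?thesis
    using assms(2) by (metis compact_Int_closed inf.absorb2 inf_commute)
qed

text \<open>
  The components of \<open>a\<close> at the levels below \<open>s\<close> form a chain of compact connected sets, so their
  intersection is connected; it is contained in the superlevel set of level \<open>s\<close>.
\<close>

lemma connected_component_superlevel_limit:
  fixes p :: "'a::euclidean_space \<Rightarrow> real"
  assumes "continuous_on UNIV p" "compact (density_support p)" "0 < s"
    and below: "\<And>t. 0 < t \<Longrightarrow> t < s \<Longrightarrow> connected_component {x. t \<le> p x} a b"
  shows "connected_component {x. s \<le> p x} a b"
proof -
  define \<F> where "\<F> = (\<lambda>t. connected_component_set {x. t \<le> p x} a) ` {0<..<s}"
  have "connected (\<Inter>\<F>)"
  proof (rule connected_chain)
    show "compact S \<and> connected S" if S: "S \<in> \<F>" for S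
    proof -
      obtain t where t: "0 < t" "S = connected_component_set {x. t \<le> p x} a"
        using S unfolding \<F>_def by auto
      have "compact {x. t \<le> p x}"
        using assms(1,2) t(1) by (rule compact_superlevel)
      then show ?thesis
        unfolding t(2)
        by (metis closed_connected_component compact_Int_closed compact_imp_closed
            connected_component_subset connected_connected_component inf.absorb_iff2)
    qed
    show "S \<subseteq> T \<or> T \<subseteq> S" if ST: "S \<in> \<F> \<and> T \<in> \<F>" for S T
    proof -
      obtain t u where "S = connected_component_set {x. t \<le> p x} a"
        "T = connected_component_set {x. u \<le> p x} a"
        using ST unfolding \<F>_def by auto
      then show ?thesis
        by (cases "t \<le> u")
          (auto intro: connected_component_of_subset[where S = "{x. u \<le> p x}"]
            connected_component_of_subset[where S = "{x. t \<le> p x}"])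
    qed
  qed
  moreover have "a \<in> \<Inter>\<F>"
    using below connected_component_in connected_component_refl unfolding \<F>_def by fastforce
  moreover have "b \<in> \<Inter>\<F>"
    using below unfolding \<F>_def by auto
  moreover have "\<Inter>\<F> \<subseteq> {x. s \<le> p x}"
  proof
    fix x assume x: "x \<in> \<Inter>\<F>"
    have "t \<le> p x" if "0 < t" "t < s" for t
      using x that connected_component_in unfolding \<F>_def by fastforce
    then have "s \<le> p x"
      by (meson assms(3) dense_le_bounded)
    then show "x \<in> {x. s \<le> p x}" by simp
  qed
  ultimately show ?thesis
    unfolding connected_component_def by blast
qed

text \<open>
  In an open set, a connection can be realised by a path, and \<open>p\<close> attains its minimum on the path.
\<close>

lemma connected_component_superlevel_above:
  fixes p :: "'a::euclidean_space \<Rightarrow> real"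
  assumes "continuous_on UNIV p" "connected_component {x. s < p x} a b"
  shows "\<exists>t>s. connected_component {x. t \<le> p x} a b"
proof -
  have "open {x. s < p x}"
    using assms(1) by (intro open_Collect_less) auto
  then have "path_component {x. s < p x} a b"
    using assms(2) by (simp add: open_path_connected_component)
  then obtain g where g: "path g" "path_image g \<subseteq> {x. s < p x}" "pathstart g = a" "pathfinish g = b"
    unfolding path_component_def by blast
  obtain m where m: "m \<in> path_image g" "\<And>x. x \<in> path_image g \<Longrightarrow> p m \<le> p x"
    using continuous_attains_inf[OF compact_path_image[OF g(1)] path_image_nonempty]
      continuous_on_subset[OF assms(1)] by blast
  have "connected_component {x. p m \<le> p x} a b"
    unfolding connected_component_def
    using connected_path_image[OF g(1)] m(2) g(3,4) pathstart_in_path_image pathfinish_in_path_image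
    by blast
  then show ?thesis using m(1) g(2) by blast
qed

text \<open>
  The split level is the supremum of the levels at which \<open>a\<close> and \<open>b\<close> are still connected. By
  compactness they are connected in the closed superlevel set of that level, but they are not connected
  in the open one, since by \<open>connected_component_superlevel_above\<close> a connection there would persist at
  a higher level. Connectedness of \<open>{x. 0 < p x}\<close> makes the supremum positive.
\<close>

lemma split_level_between:
  fixes p :: "'a::euclidean_space \<Rightarrow> real"
  assumes cont: "continuous_on UNIV p" and supp: "compact_connected_support p"
    and u: "0 < u" "u < p a" "u < p b" and sep: "\<not> connected_component {x. u < p x} a b"
  shows "\<exists>s\<le>u. split_level p s \<and> \<not> connected_component {x. s < p x} a b"
proof -
  define T where "T = {t. 0 < t \<and> connected_component {x. t \<le> p x} a b}"
  have "connected_component {x. 0 < p x} a b"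
    using supp u unfolding compact_connected_support_def connected_component_def by force
  then obtain t0 where t0: "t0 \<in> T"
    using connected_component_superlevel_above[OF cont] unfolding T_def by blast
  have le_u: "t \<le> u" if "t \<in> T" for t
  proof (rule ccontr)
    assume "\<not> t \<le> u"
    then have "{x. t \<le> p x} \<subseteq> {x. u < p x}" by auto
    moreover have "connected_component {x. t \<le> p x} a b" using that unfolding T_def by simp
    ultimately show False
      using sep connected_component_of_subset by metis
  qed
  define s where "s = Sup T"
  have bdd: "bdd_above T" using le_u by (meson bdd_aboveI)
  have "t0 \<le> s" unfolding s_def using t0 bdd by (rule cSup_upper)
  then have "0 < s" using t0 unfolding T_def by simp
  have "s \<le> u" unfolding s_def using t0 le_u by (intro cSup_least) auto
  have conn: "connected_component {x. s \<le> p x} a b"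
  proof (rule connected_component_superlevel_limit[OF cont])
    show "compact (density_support p)" using supp unfolding compact_connected_support_def by simp
    fix t assume "0 < t" "t < s"
    then obtain t' where t': "t' \<in> T" "t < t'"
      unfolding s_def using less_cSup_iff[OF _ bdd] t0 by blast
    then show "connected_component {x. t \<le> p x} a b"
      unfolding T_def by (auto intro: connected_component_of_subset)
  qed fact
  have disc: "\<not> connected_component {x. s < p x} a b"
  proof
    assume "connected_component {x. s < p x} a b"
    then obtain t where "t > s" "connected_component {x. t \<le> p x} a b"
      using connected_component_superlevel_above[OF cont] by blast
    moreover from this have "t \<in> T" using \<open>0 < s\<close> unfolding T_def by simp
    ultimately show False
      using cSup_upper[OF _ bdd, of t] unfolding s_def by simp
  qed
  have "split_level p s"
  proof -
    define C where "C = connected_component_set {x. s \<le> p x} a"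
    define E where "E = C \<inter> {x. s < p x}"
    have "s < p a" "s < p b" using \<open>s \<le> u\<close> u by auto
    then have ab: "a \<in> E" "b \<in> E"
      using conn unfolding E_def C_def by auto
    have "\<not> connected_component E a b"
      using disc connected_component_of_subset[of E a b "{x. s < p x}"] unfolding E_def by blast
    then have "connected_component_set E a \<noteq> connected_component_set E b"
      using ab by (simp add: connected_component_eq_eq)
    then have two: "\<exists>D\<in>components E. \<exists>D'\<in>components E. D \<noteq> D'"
      by (rule bexI[OF bexI[OF _ componentsI[OF ab(2)]] componentsI[OF ab(1)]])
    have "C \<in> components {x. s \<le> p x}"
      unfolding C_def using \<open>s < p a\<close> by (intro componentsI) simp
    with two show ?thesis
      unfolding split_level_def E_def using \<open>0 < s\<close> by simp (rule bexI[where x = C])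
  qed
  then show ?thesis using \<open>s \<le> u\<close> disc by blast
qed

section \<open>Cluster trees and the neighbourhood graph\<close>

lemma dbscan_edges_mono:
  assumes "l \<le> l'"
  shows "dbscan_edges K h n x l' \<subseteq> dbscan_edges K h n x l"
  using assms unfolding dbscan_edges_def dbscan_nodes_def by auto

lemma equiv_dbscan_edges: "equiv UNIV ((dbscan_edges K h n x l)\<^sup>*)"
proof (rule equivI)
  have "sym (dbscan_edges K h n x l)"
    unfolding dbscan_edges_def by (auto simp: sym_def norm_minus_commute)
  then show "sym ((dbscan_edges K h n x l)\<^sup>*)" by (rule sym_rtrancl)
qed (auto simp: refl_rtrancl trans_rtrancl)

lemma dbscan_path_in_nodes:
  assumes "(y, z) \<in> (dbscan_edges K h n x l)\<^sup>*" "y \<in> dbscan_nodes K h n x l"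
  shows "z \<in> dbscan_nodes K h n x l"
  using assms by (induction) (auto simp: dbscan_edges_def)

lemma dbscan_cases:
  assumes "A \<in> dbscan K h n x l"
  obtains y where "y \<in> dbscan_nodes K h n x l" "A = (dbscan_edges K h n x l)\<^sup>* `` {y}"
  using assms unfolding dbscan_def by (auto elim: quotientE)

lemma dbscan_nonempty: "A \<in> dbscan K h n x l \<Longrightarrow> A \<noteq> {}"
  by (auto elim: dbscan_cases)

lemma cluster_tree_dbscan: "cluster_tree (sample_points n x) (dbscan K h n x)"
proof -
  have sub: "A \<subseteq> sample_points n x" if "A \<in> dbscan K h n x l" for A l
    using that
    by (elim dbscan_cases) (auto dest!: dbscan_path_in_nodes simp: dbscan_nodes_def)
  have nested: "A \<inter> B = {} \<or> A \<subseteq> B"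
    if "l2 \<le> l1" "A \<in> dbscan K h n x l1" "B \<in> dbscan K h n x l2" for A B l1 l2
  proof -
    obtain y where y: "A = (dbscan_edges K h n x l1)\<^sup>* `` {y}"
      using \<open>A \<in> dbscan K h n x l1\<close> by (elim dbscan_cases)
    obtain z where z: "B = (dbscan_edges K h n x l2)\<^sup>* `` {z}"
      using \<open>B \<in> dbscan K h n x l2\<close> by (elim dbscan_cases)
    have mono: "(dbscan_edges K h n x l1)\<^sup>* \<subseteq> (dbscan_edges K h n x l2)\<^sup>*"
      using dbscan_edges_mono[OF \<open>l2 \<le> l1\<close>] by (rule rtrancl_mono)
    have s: "sym ((dbscan_edges K h n x l1)\<^sup>*)"
      using equiv_dbscan_edges by (rule equivE)
    show ?thesis
    proof (rule disjCI)
      assume "\<not> A \<subseteq> B"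
      show "A \<inter> B = {}"
      proof (rule ccontr)
        assume "A \<inter> B \<noteq> {}"
        then obtain w where w: "(y, w) \<in> (dbscan_edges K h n x l1)\<^sup>*" "(z, w) \<in> (dbscan_edges K h n x l2)\<^sup>*"
          using y z by auto
        have "(z, v) \<in> (dbscan_edges K h n x l2)\<^sup>*" if "(y, v) \<in> (dbscan_edges K h n x l1)\<^sup>*" for v
          using w that symD[OF s w(1)] mono by (meson rtrancl_trans subsetD)
        then show False using \<open>\<not> A \<subseteq> B\<close> y z by auto
      qed
    qed
  qed
  have disj: "A \<inter> B = {}" if "A \<in> dbscan K h n x l" "B \<in> dbscan K h n x l" "A \<noteq> B" for A B l
    using nested[of l l A B] nested[of l l B A] that by blast
  show ?thesis
    unfolding cluster_tree_def using sub nested disj by blast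
qed

text \<open>
  All clusters containing the nonempty set \<open>Q\<close> meet, hence are nested; a minimal one is the least one.
\<close>

lemma smallest_cluster_exists:
  assumes tree: "cluster_tree S T" and "finite S" and "0 \<le> l" "D \<in> T l" and Q: "Q \<subseteq> D" "Q \<noteq> {}"
  shows "\<exists>C\<subseteq>D. smallest_cluster T Q C"
proof -
  define F where "F = {B \<in> (\<Union>l\<in>{0..}. T l). Q \<subseteq> B}"
  have "F \<subseteq> Pow S"
    using tree unfolding cluster_tree_def F_def by auto
  then have "finite F" using \<open>finite S\<close> by (meson finite_Pow_iff finite_subset)
  moreover have "D \<in> F" using assms unfolding F_def by auto
  ultimately obtain C where C: "C \<in> F" "C \<subseteq> D" "\<And>B. B \<in> F \<Longrightarrow> B \<subseteq> C \<Longrightarrow> C = B"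
    using finite_has_minimal2[of F D] by blast
  have "C \<subseteq> B" if B: "B \<in> F" for B
  proof -
    obtain i j where ij: "0 \<le> i" "0 \<le> j" "C \<in> T i" "B \<in> T j"
      using B C(1) unfolding F_def by auto
    have "C \<inter> B \<noteq> {}" using B C(1) Q unfolding F_def by auto
    then have "C \<subseteq> B \<or> B \<subseteq> C"
      using tree ij unfolding cluster_tree_def by (metis inf_commute linear)
    then show ?thesis using C(3) B by blast
  qed
  then show ?thesis
    using C(1,2) unfolding smallest_cluster_def F_def by auto
qed

text \<open>
  A smallest cluster containing the empty set is contained in all clusters. Thus the two alternatives
  in the definition of accuracy exclude each other.
\<close>

lemma not_smallest_clusters_disjoint_empty:
  assumes ne: "\<And>l C. C \<in> T l \<Longrightarrow> C \<noteq> {}" and "Q = {} \<or> Q' = {}"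
  shows "\<not> smallest_clusters_disjoint T Q Q'"
proof
  assume "smallest_clusters_disjoint T Q Q'"
  then obtain C C' where C: "smallest_cluster T Q C" "smallest_cluster T Q' C'" "C \<inter> C' = {}"
    unfolding smallest_clusters_disjoint_def by blast
  then have "C \<noteq> {}" "C' \<noteq> {}" using ne unfolding smallest_cluster_def by auto
  moreover have "C \<subseteq> C' \<or> C' \<subseteq> C"
    using C(1,2) assms(2) unfolding smallest_cluster_def by (metis empty_subsetI)
  ultimately show False using C(3) by blast
qed

text \<open>
  Assign to each point of \<open>A\<close> a node within \<open>h / 2\<close>. Points of \<open>A\<close> closer than \<open>h\<close> to each other have
  nodes closer than \<open>2 h\<close>, so the component of the assigned node in the graph is locally constant on
  \<open>A\<close>, hence constant.
\<close>

lemma dbscan_connects: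
  assumes "connected A" and "0 < h"
    and dense: "\<And>z. z \<in> A \<Longrightarrow> \<exists>w\<in>dbscan_nodes K h n x l. dist z w \<le> h / 2"
    and y: "y \<in> A" "y \<in> dbscan_nodes K h n x l" and z: "z \<in> A" "z \<in> dbscan_nodes K h n x l"
  shows "(y, z) \<in> (dbscan_edges K h n x l)\<^sup>*"
proof -
  let ?E = "dbscan_edges K h n x l"
  have edge: "(v, w) \<in> ?E\<^sup>*"
    if "v \<in> dbscan_nodes K h n x l" "w \<in> dbscan_nodes K h n x l" "dist v w < 2 * h" for v w
    using that unfolding dbscan_edges_def by (auto simp: dist_norm)
  obtain f where f: "\<And>z. z \<in> A \<Longrightarrow> f z \<in> dbscan_nodes K h n x l"
    "\<And>z. z \<in> A \<Longrightarrow> dist z (f z) \<le> h / 2"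
    using dense by metis
  have "(f y, f z) \<in> ?E\<^sup>*"
  proof (rule connected_equivalence_relation[OF \<open>connected A\<close> y(1) z(1),
        where R = "\<lambda>u v. (f u, f v) \<in> ?E\<^sup>*"])
    fix u v assume "(f u, f v) \<in> ?E\<^sup>*"
    then show "(f v, f u) \<in> ?E\<^sup>*"
      using equiv_dbscan_edges[of K h n x l] by (meson equivE symD)
  next
    fix u assume u: "u \<in> A"
    have "(f u, f v) \<in> ?E\<^sup>*" if v: "v \<in> A \<inter> ball u h" for v
    proof (rule edge)
      have "dist (f u) (f v) \<le> dist u (f u) + dist u v + dist v (f v)"
        by (metis (no_types, opaque_lifting) add.commute add_left_mono dist_commute dist_triangle2 dist_triangle order_trans)
      then show "dist (f u) (f v) < 2 * h"
        using f(2)[OF u] f(2)[of v] v by auto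
    qed (use f u v in auto)
    then show "\<exists>T. openin (top_of_set A) T \<and> u \<in> T \<and> (\<forall>v\<in>T. (f u, f v) \<in> ?E\<^sup>*)"
      using u \<open>0 < h\<close> by (intro exI[of _ "A \<inter> ball u h"]) (auto simp: openin_open_Int)
  qed (auto intro: rtrancl_trans)
  moreover have "(y, f y) \<in> ?E\<^sup>*"
    using f[OF y(1)] y(2) \<open>0 < h\<close> by (intro edge) auto
  moreover have "(f z, z) \<in> ?E\<^sup>*"
    using f[OF z(1)] z(2) \<open>0 < h\<close> by (intro edge) (auto simp: dist_commute)
  ultimately show ?thesis by (meson rtrancl_trans)
qed

lemma dbscan_cluster_in_component:
  assumes nodes: "\<And>y. y \<in> dbscan_nodes K h n x l \<Longrightarrow> y \<in> V"
    and sep: "\<And>y z. y \<in> dbscan_nodes K h n x l \<Longrightarrow> z \<in> dbscan_nodes K h n x l \<Longrightarrow>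
      \<not> connected_component V y z \<Longrightarrow> 2 * h \<le> dist y z"
    and y: "y \<in> dbscan_nodes K h n x l" and "(y, z) \<in> (dbscan_edges K h n x l)\<^sup>*"
  shows "connected_component V y z"
  using assms(4)
proof (induction rule: rtrancl_induct)
  case base
  then show ?case using nodes[OF y] by simp
next
  case (step z w)
  then have "connected_component V z w"
    using sep[of z w] unfolding dbscan_edges_def by (force simp: dist_norm)
  then show ?case using step connected_component_trans by metis
qed

text \<open>
  The deterministic part of the argument. The hypothesis \<open>est\<close> is the uniform error bound, \<open>gap\<close> is what
  remains of condition S, and \<open>dense\<close> holds with high probability by condition C.
\<close>

lemma dbscan_resolves_separated_sets:
  fixes p :: "'a::euclidean_space \<Rightarrow> real"
  assumes cont: "continuous_on UNIV p" and supp: "compact_connected_support p"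
    and nonneg: "\<And>y. 0 \<le> p y" and "0 < h" "0 < t"
    and est: "\<And>y. \<bar>kde K h n x y - p y\<bar> \<le> a"
    and gap: "\<And>l y z. split_level p l \<Longrightarrow> l + t \<le> p y \<Longrightarrow> l + t \<le> p z \<Longrightarrow>
      \<not> connected_component {x. l < p x} y z \<Longrightarrow> 2 * h \<le> dist y z"
    and dense: "\<And>l y. split_level p l \<Longrightarrow> l + (2 * a + t) \<le> p y \<Longrightarrow>
      \<exists>i<n. l + (2 * a + t) \<le> p (x i) \<and> dist y (x i) \<le> h / 2"
    and \<delta>: "2 * a + t \<le> \<delta>"
    and A: "connected A" "connected A'" "delta_separated p \<delta> A A'"
  shows "(A \<inter> sample_points n x = {} \<or> A' \<inter> sample_points n x = {}) \<noteq>
    smallest_clusters_disjoint (dbscan K h n x) (A \<inter> sample_points n x) (A' \<inter> sample_points n x)"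
proof (cases "A \<inter> sample_points n x = {} \<or> A' \<inter> sample_points n x = {}")
  case True
  then show ?thesis
    using not_smallest_clusters_disjoint_empty[where T = "dbscan K h n x"] dbscan_nonempty by metis
next
  case False
  define S where "S = sample_points n x"
  from False obtain b b' where b: "b \<in> A" "b \<in> S" "b' \<in> A'" "b' \<in> S"
    unfolding S_def by blast
  have "0 \<le> a" using est[of 0] by linarith
  define m where "m = Inf (p ` (A \<union> A'))"
  have above: "m \<le> p y" if "y \<in> A \<union> A'" for y
    unfolding m_def using that nonneg by (intro cInf_lower bdd_belowI[of _ 0]) auto
  obtain C C' where C: "0 < \<delta>" "\<delta> < m" "C \<in> components {x. m - \<delta> < p x}"
    "C' \<in> components {x. m - \<delta> < p x}" "C \<noteq> C'" "A \<subseteq> C" "A' \<subseteq> C'"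
    using A(3) unfolding delta_separated_def Let_def m_def[symmetric] by blast
  have "C = connected_component_set {x. m - \<delta> < p x} b"
    "C' = connected_component_set {x. m - \<delta> < p x} b'"
    using C(3,4) subsetD[OF C(6) b(1)] subsetD[OF C(7) b(3)] connected_component_eq
    by (fastforce simp: components_iff)+
  then have "\<not> connected_component {x. m - \<delta> < p x} b b'"
    using C(5) connected_component_eq[of b' "{x. m - \<delta> < p x}" b] by auto
  then obtain s where s: "s \<le> m - \<delta>" "split_level p s" "\<not> connected_component {x. s < p x} b b'"
    using split_level_between[OF cont supp, of "m - \<delta>" b b'] C(1,2) above[of b] above[of b'] b by auto
  have "0 < s" using s(2) unfolding split_level_def by simp
  (* A node of this level has p at least s + t, and a sample point with p at least s + (2 a + t)
     is a node: the error a of the density estimate is lost once in each direction. *)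
  define l where "l = s + a + t"
  let ?N = "dbscan_nodes K h n x l" and ?E = "dbscan_edges K h n x l"
  have "0 \<le> l" unfolding l_def using \<open>0 < s\<close> \<open>0 < t\<close> \<open>0 \<le> a\<close> by simp
  have node_I: "y \<in> ?N" if "y \<in> S" "s + (2 * a + t) \<le> p y" for y
    using that est[of y] unfolding dbscan_nodes_def S_def l_def by auto
  have node_D: "s + t \<le> p y" if "y \<in> ?N" for y
    using that est[of y] unfolding dbscan_nodes_def l_def by auto
  have high: "s + (2 * a + t) \<le> p y" if "y \<in> A \<union> A'" for y
    using above[OF that] s(1) \<delta> by linarith
  have near: "\<exists>w\<in>?N. dist y w \<le> h / 2" if y: "y \<in> A \<union> A'" for y
  proof -
    obtain i where "i < n" "s + (2 * a + t) \<le> p (x i)" "dist y (x i) \<le> h / 2"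
      using dense[OF s(2) high[OF y]] by blast
    then show ?thesis
      using node_I[of "x i"] unfolding S_def sample_points_def by blast
  qed
  have cover: "B \<inter> S \<subseteq> ?E\<^sup>* `` {c}" if "connected B" "B \<subseteq> A \<union> A'" "c \<in> B \<inter> S" for B c
  proof
    fix y assume "y \<in> B \<inter> S"
    then show "y \<in> ?E\<^sup>* `` {c}"
      using that node_I high near dbscan_connects[OF that(1) \<open>0 < h\<close>, of K n x l c y] by blast
  qed
  have comp: "connected_component {x. s < p x} y z" if "y \<in> ?N" "(y, z) \<in> ?E\<^sup>*" for y z
    using that gap[OF s(2)] node_D \<open>0 < t\<close>
    by (intro dbscan_cluster_in_component[of K h n x l "{x. s < p x}" y z]) (auto dest!: node_D)
  have N: "b \<in> ?N" "b' \<in> ?N" using node_I high b by auto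
  have clusters: "?E\<^sup>* `` {b} \<in> dbscan K h n x l" "?E\<^sup>* `` {b'} \<in> dbscan K h n x l"
    using N unfolding dbscan_def by (auto intro: quotientI)
  have disj: "?E\<^sup>* `` {b} \<inter> ?E\<^sup>* `` {b'} = {}"
    using comp[OF N(1)] comp[OF N(2)] s(3)
    by (auto dest: connected_component_sym connected_component_trans)
  have "finite S" unfolding S_def sample_points_def by simp
  note small = smallest_cluster_exists[OF
      cluster_tree_dbscan[where K = K and h = h and n = n and x = x, folded S_def]
      \<open>finite S\<close> \<open>0 \<le> l\<close>]
  obtain D where D: "D \<subseteq> ?E\<^sup>* `` {b}" "smallest_cluster (dbscan K h n x) (A \<inter> S) D"
    using small[OF clusters(1) cover[OF A(1)]] b by blast
  obtain D' where D': "D' \<subseteq> ?E\<^sup>* `` {b'}" "smallest_cluster (dbscan K h n x) (A' \<inter> S) D'"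
    using small[OF clusters(2) cover[OF A(2)]] b by blast
  have "smallest_clusters_disjoint (dbscan K h n x) (A \<inter> S) (A' \<inter> S)"
    unfolding smallest_clusters_disjoint_def using D D' disj by blast
  then show ?thesis using False unfolding S_def by simp
qed


section \<open>Random samples hit every ball of the cover\<close>

lemma distributed_prob_ge:
  fixes p :: "'a::euclidean_space \<Rightarrow> real"
  assumes "prob_space M" "distributed M lborel X (\<lambda>x. ennreal (p x))"
    and B: "B \<in> sets borel" "bounded B" and u: "0 \<le> u" "\<And>x. x \<in> B \<Longrightarrow> u \<le> p x"
  shows "u * measure lborel B \<le> measure M (X -` B \<inter> space M)"
proof -
  interpret prob_space M by fact
  have fin: "emeasure lborel B < \<infinity>"
    using B(2) by (rule emeasure_bounded_finite)
  have "ennreal (u * measure lborel B) = ennreal u * emeasure lborel B"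
    using u(1) fin by (simp add: ennreal_mult emeasure_eq_ennreal_measure)
  also have "\<dots> = (\<integral>\<^sup>+x. ennreal u * indicator B x \<partial>lborel)"
    using B(1) by (simp add: nn_integral_cmult_indicator)
  also have "\<dots> \<le> (\<integral>\<^sup>+x. ennreal (p x) * indicator B x \<partial>lborel)"
    using u by (intro nn_integral_mono) (auto split: split_indicator intro: ennreal_leI)
  also have "\<dots> = emeasure M (X -` B \<inter> space M)"
    using B(1) assms(2) by (simp add: distributed_emeasure)
  also have "\<dots> = ennreal (measure M (X -` B \<inter> space M))"
    by (simp add: emeasure_eq_measure)
  finally show ?thesis by (simp add: ennreal_le_iff)
qed

lemma prob_sample_misses_le:
  fixes p :: "'a::euclidean_space \<Rightarrow> real"
  assumes iid: "iid_from_density M X p"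
    and B: "B \<in> sets borel" and q: "\<And>i. q \<le> measure M (X i -` B \<inter> space M)"
  shows "{\<omega> \<in> space M. \<forall>i<n. X i \<omega> \<notin> B} \<in> sets M"
    and "measure M {\<omega> \<in> space M. \<forall>i<n. X i \<omega> \<notin> B} \<le> exp (- (real n * q))"
proof -
  interpret prob_space M using iid unfolding iid_from_density_def by simp
  have indep: "indep_vars (\<lambda>_. borel) X UNIV" using iid unfolding iid_from_density_def by simp
  have X [measurable]: "X i \<in> borel_measurable M" for i
    using indep unfolding indep_vars_def by simp
  note [measurable] = B
  show "{\<omega> \<in> space M. \<forall>i<n. X i \<omega> \<notin> B} \<in> sets M" by measurable
  show "measure M {\<omega> \<in> space M. \<forall>i<n. X i \<omega> \<notin> B} \<le> exp (- (real n * q))"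
  proof (cases "n = 0")
    case False
    have eq: "{\<omega> \<in> space M. \<forall>i<n. X i \<omega> \<notin> B} = (\<Inter>i\<in>{..<n}. X i -` (- B) \<inter> space M)"
      using False by auto
    have miss: "prob (X i -` (- B) \<inter> space M) \<le> exp (- q)" for i
    proof -
      have "X i -` (- B) \<inter> space M = space M - (X i -` B \<inter> space M)" by auto
      moreover have "X i -` B \<inter> space M \<in> events" by measurable
      ultimately have "prob (X i -` (- B) \<inter> space M) = 1 - prob (X i -` B \<inter> space M)"
        by (simp add: prob_compl)
      also have "\<dots> \<le> 1 + - q" using q[of i] by simp
      also have "\<dots> \<le> exp (- q)" by (rule exp_ge_add_one_self)
      finally show ?thesis .
    qed
    have "prob {\<omega> \<in> space M. \<forall>i<n. X i \<omega> \<notin> B} = (\<Prod>i<n. prob (X i -` (- B) \<inter> space M))"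
      unfolding eq using False B by (intro indep_varsD[OF indep]) auto
    also have "\<dots> \<le> (\<Prod>i<n. exp (- q))"
      using miss by (intro prod_mono) auto
    also have "\<dots> = exp (- (real n * q))"
      by (simp add: exp_of_nat_mult[symmetric])
    finally show ?thesis .
  qed simp
qed

text \<open>
  If each set \<open>cball y r \<inter> {x. l + \<epsilon> \<le> p x}\<close> with a centre \<open>y\<close> of the cover contains a sample point,
  then one lies within \<open>2 r\<close> of every point of \<open>{x. l + \<epsilon> \<le> p x}\<close>. Each of these sets
  has probability at least \<open>u * (c\<^sub>I * V * r ^ d)\<close>, because the centre belongs to the superlevel set,
  which is inner regular, and \<open>p\<close> is at least \<open>u\<close> there.
\<close>

lemma prob_sample_dense_in_superlevel_sets:
  fixes p :: "'a::euclidean_space \<Rightarrow> real"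
  defines "d \<equiv> DIM('a)" and "V \<equiv> measure lebesgue (cball (0::'a) 1)"
  assumes iid: "iid_from_density M X p" and meas: "p \<in> borel_measurable borel"
    and "finite \<Lambda>" "0 < u" "\<And>l. l \<in> \<Lambda> \<Longrightarrow> u \<le> l" "0 < \<epsilon>" "0 < r" "r \<le> r\<^sub>I"
    and reg: "\<And>l. l \<in> \<Lambda> \<Longrightarrow> inner_regular_set r\<^sub>I c\<^sub>I {x. l + \<epsilon> \<le> p x}"
    and cov: "\<And>l. l \<in> \<Lambda> \<Longrightarrow> coverable_set r\<^sub>I C\<^sub>I {x. l + \<epsilon> \<le> p x}"
  shows "prob_at_least M
      (1 - real (card \<Lambda>) * (C\<^sub>I * r powr (- real d)) * exp (- (real n * (u * (c\<^sub>I * V * r ^ d)))))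
      (\<lambda>\<omega>. \<forall>l\<in>\<Lambda>. \<forall>y. l + \<epsilon> \<le> p y \<longrightarrow>
         (\<exists>i<n. l + \<epsilon> \<le> p (X i \<omega>) \<and> dist y (X i \<omega>) \<le> 2 * r))"
proof -
  interpret prob_space M using iid unfolding iid_from_density_def by simp
  define \<Omega> where "\<Omega> l = {x. l + \<epsilon> \<le> p x}" for l
  have \<Omega> [measurable]: "\<Omega> l \<in> sets borel" for l
    unfolding \<Omega>_def using meas by measurable
  have "\<exists>N\<subseteq>\<Omega> l. finite N \<and> real (card N) \<le> C\<^sub>I * r powr (- real d) \<and> \<Omega> l \<subseteq> (\<Union>y\<in>N. cball y r)"
    if "l \<in> \<Lambda>" for l
    using cov[OF that] \<open>0 < r\<close> \<open>r \<le> r\<^sub>I\<close> unfolding coverable_set_def \<Omega>_def d_def by blast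
  then obtain N where N: "\<And>l. l \<in> \<Lambda> \<Longrightarrow> N l \<subseteq> \<Omega> l" "\<And>l. l \<in> \<Lambda> \<Longrightarrow> finite (N l)"
    "\<And>l. l \<in> \<Lambda> \<Longrightarrow> real (card (N l)) \<le> C\<^sub>I * r powr (- real d)"
    "\<And>l. l \<in> \<Lambda> \<Longrightarrow> \<Omega> l \<subseteq> (\<Union>y\<in>N l. cball y r)"
    by metis
  define q where "q = u * (c\<^sub>I * V * r ^ d)"
  define miss where "miss = (\<lambda>(l, y). {\<omega> \<in> space M. \<forall>i<n. X i \<omega> \<notin> cball y r \<inter> \<Omega> l})"
  define I where "I = Sigma \<Lambda> N"
  have miss: "miss k \<in> events" "prob (miss k) \<le> exp (- (real n * q))" if k: "k \<in> I" for k
  proof -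
    obtain l y where ly: "k = (l, y)" "l \<in> \<Lambda>" "y \<in> N l" using k unfolding I_def by auto
    have B: "cball y r \<inter> \<Omega> l \<in> sets borel" by simp
    have "c\<^sub>I * V * r ^ d \<le> measure lebesgue (cball y r \<inter> \<Omega> l)"
      using reg[OF ly(2)] N(1)[OF ly(2)] ly(3) \<open>0 < r\<close> \<open>r \<le> r\<^sub>I\<close>
      unfolding inner_regular_set_def \<Omega>_def V_def d_def by (auto simp: subset_iff)
    also have "\<dots> = measure lborel (cball y r \<inter> \<Omega> l)"
      using B by simp
    finally have "q \<le> u * measure lborel (cball y r \<inter> \<Omega> l)"
      unfolding q_def using \<open>0 < u\<close> by simp
    also have "\<dots> \<le> prob (X i -` (cball y r \<inter> \<Omega> l) \<inter> space M)" for i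
    proof (rule distributed_prob_ge[OF prob_space_axioms])
      show "distributed M lborel (X i) (\<lambda>x. ennreal (p x))"
        using iid unfolding iid_from_density_def by simp
      show "u \<le> p x" if "x \<in> cball y r \<inter> \<Omega> l" for x
        using that assms(7)[OF ly(2)] \<open>0 < \<epsilon>\<close> unfolding \<Omega>_def by simp
    qed (use B \<open>0 < u\<close> in auto)
    finally have q: "q \<le> prob (X i -` (cball y r \<inter> \<Omega> l) \<inter> space M)" for i .
    note bound = prob_sample_misses_le[OF iid B q, where n = n]
    show "miss k \<in> events"
      unfolding miss_def ly(1) prod.case by (rule bound(1))
    show "prob (miss k) \<le> exp (- (real n * q))"
      unfolding miss_def ly(1) prod.case by (rule bound(2))
  qed
  have "finite I" unfolding I_def using \<open>finite \<Lambda>\<close> N(2) by auto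
  have "real (card I) = (\<Sum>l\<in>\<Lambda>. real (card (N l)))"
    unfolding I_def using \<open>finite \<Lambda>\<close> N(2) by (simp add: card_SigmaI)
  also have "\<dots> \<le> real (card \<Lambda>) * (C\<^sub>I * r powr (- real d))"
    using sum_mono[of \<Lambda>, OF N(3)] by simp
  finally have card: "real (card I) \<le> real (card \<Lambda>) * (C\<^sub>I * r powr (- real d))" .
  define E where "E = space M - (\<Union>k\<in>I. miss k)"
  have ev: "(\<Union>k\<in>I. miss k) \<in> events" using \<open>finite I\<close> miss(1) by blast
  have "prob (\<Union>k\<in>I. miss k) \<le> (\<Sum>k\<in>I. prob (miss k))"
    using \<open>finite I\<close> miss(1) by (intro finite_measure_subadditive_finite) auto
  also have "\<dots> \<le> real (card I) * exp (- (real n * q))"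
    using sum_mono[of I, OF miss(2)] by simp
  also have "\<dots> \<le> real (card \<Lambda>) * (C\<^sub>I * r powr (- real d)) * exp (- (real n * q))"
    using card by (intro mult_right_mono) auto
  finally have "1 - real (card \<Lambda>) * (C\<^sub>I * r powr (- real d)) * exp (- (real n * q)) \<le> prob E"
    unfolding E_def using ev by (simp add: prob_compl)
  moreover have "E \<in> events" unfolding E_def using ev by auto
  moreover have "\<exists>i<n. l + \<epsilon> \<le> p (X i \<omega>) \<and> dist y (X i \<omega>) \<le> 2 * r"
    if "\<omega> \<in> E" "l \<in> \<Lambda>" "l + \<epsilon> \<le> p y" for \<omega> l y
  proof -
    have "y \<in> \<Omega> l" using that(3) unfolding \<Omega>_def by simp
    then obtain z where z: "z \<in> N l" "dist z y \<le> r" using N(4)[OF \<open>l \<in> \<Lambda>\<close>] by auto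
    then have "(l, z) \<in> I" using \<open>l \<in> \<Lambda>\<close> unfolding I_def by simp
    then obtain i where i: "i < n" "X i \<omega> \<in> cball z r \<inter> \<Omega> l"
      using \<open>\<omega> \<in> E\<close> unfolding E_def miss_def by blast
    then have "dist y (X i \<omega>) \<le> 2 * r"
      using z(2) dist_triangle[of y "X i \<omega>" z] by (simp add: dist_commute)
    then show ?thesis using i unfolding \<Omega>_def by auto
  qed
  ultimately show ?thesis unfolding prob_at_least_def q_def by blast
qed

lemma prob_at_least_conj:
  assumes "prob_space M" "prob_at_least M (1 - a) P" "prob_at_least M (1 - b) Q"
  shows "prob_at_least M (1 - (a + b)) (\<lambda>\<omega>. P \<omega> \<and> Q \<omega>)"
proof -
  interpret prob_space M by fact
  obtain E F where E: "E \<in> events" "\<forall>\<omega>\<in>E. P \<omega>" "1 - a \<le> prob E"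
    and F: "F \<in> events" "\<forall>\<omega>\<in>F. Q \<omega>" "1 - b \<le> prob F"
    using assms(2,3) unfolding prob_at_least_def by blast
  have "prob (E \<union> F) = prob E + prob F - prob (E \<inter> F)"
    using E(1) F(1) by (simp add: measure_Un3 emeasure_eq_measure fmeasurable_eq_sets)
  then have "1 - (a + b) \<le> prob (E \<inter> F)"
    using E(3) F(3) prob_le_1[of "E \<union> F"] by linarith
  then show ?thesis using E F unfolding prob_at_least_def by (intro bexI[of _ "E \<inter> F"]) auto
qed

section \<open>Asymptotics of the bandwidth\<close>

lemma bigo_tendsto_0:
  fixes f g :: "nat \<Rightarrow> real"
  assumes "f \<in> O(g)" and lim: "g \<longlonglongrightarrow> 0"
  shows "f \<longlonglongrightarrow> 0"
proof -
  obtain c where "\<forall>\<^sub>F n in sequentially. norm (f n) \<le> c * norm (g n)"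
    using assms(1) by (elim landau_o.bigE)
  moreover have "(\<lambda>n. c * norm (g n)) \<longlonglongrightarrow> 0"
    using tendsto_mult_left[OF tendsto_norm[OF lim], of c] by simp
  ultimately show ?thesis by (rule Lim_null_comparison)
qed

lemma bandwidth_tendsto_0:
  assumes "0 < D" "h \<in> \<Theta>(\<lambda>n. (ln (real n) / real n) powr (1 / D))"
  shows "h \<longlonglongrightarrow> 0"
  using assms(2)
proof (rule bigo_tendsto_0[OF bigthetaD1])
  show "(\<lambda>n. (ln (real n) / real n) powr (1 / D)) \<longlonglongrightarrow> 0"
    using assms(1) by real_asymp
qed

text \<open>
  The logarithm in the bandwidth can be dropped, as it is at least 1 from \<open>n = 3\<close> on.
\<close>

lemma bandwidth_volume_ge:
  fixes h :: "nat \<Rightarrow> real"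
  assumes "0 < D" "\<And>n. 0 < h n" "h \<in> \<Theta>(\<lambda>n. (ln (real n) / real n) powr (1 / D))"
  shows "\<exists>c>0. \<forall>\<^sub>F n in sequentially. c * real n powr (1 - real d / D) \<le> real n * h n ^ d"
proof -
  have "h \<in> \<Omega>(\<lambda>n. (ln (real n) / real n) powr (1 / D))"
    using assms(3) by (rule bigthetaD2)
  then obtain c where c: "0 < c"
    "\<forall>\<^sub>F n in sequentially. c * norm ((ln (real n) / real n) powr (1 / D)) \<le> norm (h n)"
    by (elim landau_omega.bigE)
  from c(2) have "\<forall>\<^sub>F n in sequentially. c ^ d * real n powr (1 - real d / D) \<le> real n * h n ^ d"
    using eventually_ge_at_top[of 3]
  proof eventually_elim
    case (elim n)
    have "1 \<le> ln (real n)"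
      using elim(2) exp_le by (subst ln_ge_iff) auto
    have "real n powr (- (1 / D)) = (1 / real n) powr (1 / D)"
      using elim(2) by (simp add: powr_minus powr_divide inverse_eq_divide)
    also have "\<dots> \<le> (ln (real n) / real n) powr (1 / D)"
      using \<open>1 \<le> ln (real n)\<close> elim(2) assms(1) by (intro powr_mono2 divide_right_mono) auto
    finally have "c * real n powr (- (1 / D)) \<le> c * (ln (real n) / real n) powr (1 / D)"
      using c(1) by (intro mult_left_mono) auto
    also have "\<dots> \<le> h n"
      using elim(1) assms(2)[of n] by simp
    finally have "(c * real n powr (- (1 / D))) ^ d \<le> h n ^ d"
      using c(1) by (intro power_mono) auto
    moreover have "(real n powr (- (1 / D))) ^ d = real n powr (- (real d / D))"
      using elim(2) by (simp add: powr_power)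
    ultimately have "real n * (c ^ d * real n powr (- (real d / D))) \<le> real n * h n ^ d"
      by (intro mult_left_mono) (auto simp: power_mult_distrib)
    moreover have "real n powr (1 - real d / D) = real n * real n powr (- (real d / D))"
      using elim(2) powr_add[of "real n" 1 "- (real d / D)"] by simp
    ultimately show ?case by (simp add: mult_ac)
  qed
  then show ?thesis using c(1) by (intro exI[of _ "c ^ d"]) auto
qed

lemma powr_eventually_dominates:
  fixes c \<beta> k :: real
  assumes "0 < c" "0 < \<beta>"
  shows "\<forall>\<^sub>F n in sequentially. k * real n powr \<beta> \<le> c * real n powr (2 * \<beta>)"
proof -
  have "\<forall>\<^sub>F n in sequentially. k / c \<le> real n powr \<beta>"
    using assms(2) by real_asymp
  then show ?thesis
  proof eventually_elim
    case (elim n)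
    then have "k \<le> c * real n powr \<beta>" using assms(1) by (simp add: field_simps)
    then have "k * real n powr \<beta> \<le> (c * real n powr \<beta>) * real n powr \<beta>"
      by (rule mult_right_mono) simp
    then show ?case by (simp add: powr_add[symmetric] mult.assoc)
  qed
qed

lemma exp_neg_powr_bigo:
  fixes \<beta> :: real
  assumes "0 < \<beta>"
  shows "(\<lambda>n. real n * exp (- (real n powr \<beta>))) \<in> O(\<lambda>n. real n powr - 1)"
  using assms by real_asymp


section \<open>Accuracy of the cluster tree\<close>

text \<open>
  Condition S at height \<open>(4 h / c\<^sub>S) powr \<alpha>\<close> above the split level; this height is the one at which
  the guaranteed distance \<open>c\<^sub>S * t powr (1 / \<alpha>)\<close> equals \<open>4 h\<close>.
\<close>

lemma condition_S_gap:
  fixes p :: "'a::euclidean_space \<Rightarrow> real"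
  assumes "1 < \<alpha>" "condition_S p \<alpha> c\<^sub>S"
  shows "\<exists>\<eta>>0. \<forall>h>0. (4 * h / c\<^sub>S) powr \<alpha> \<le> \<eta> \<longrightarrow> (\<forall>l y z. split_level p l \<longrightarrow>
    l + (4 * h / c\<^sub>S) powr \<alpha> \<le> p y \<longrightarrow> l + (4 * h / c\<^sub>S) powr \<alpha> \<le> p z \<longrightarrow>
    \<not> connected_component {x. l < p x} y z \<longrightarrow> 4 * h \<le> dist y z)"
proof -
  obtain \<eta> where \<eta>: "0 < c\<^sub>S" "0 < \<eta>"
    "\<And>l t C C'. split_level p l \<Longrightarrow> 0 < t \<Longrightarrow> t \<le> \<eta> \<Longrightarrow> C \<in> components {x. l < p x} \<Longrightarrow>
      C' \<in> components {x. l < p x} \<Longrightarrow> C \<noteq> C' \<Longrightarrow>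
      ereal (c\<^sub>S * t powr (1 / \<alpha>)) \<le> set_distance (C \<inter> {x. l + t \<le> p x}) (C' \<inter> {x. l + t \<le> p x})"
    using assms(2) unfolding condition_S_def by metis
  have "4 * h \<le> dist y z"
    if h: "0 < h" and t: "t = (4 * h / c\<^sub>S) powr \<alpha>" "t \<le> \<eta>" and l: "split_level p l"
      and yz: "l + t \<le> p y" "l + t \<le> p z" "\<not> connected_component {x. l < p x} y z" for h t l y z
  proof -
    let ?C = "connected_component_set {x. l < p x}"
    have "0 < t" using h \<eta>(1) unfolding t(1) by simp
    then have in_l: "y \<in> {x. l < p x}" "z \<in> {x. l < p x}" using yz by auto
    then have "?C y \<noteq> ?C z" using yz(3) by (simp add: connected_component_eq_eq)
    then have "ereal (c\<^sub>S * t powr (1 / \<alpha>)) \<le>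
        set_distance (?C y \<inter> {x. l + t \<le> p x}) (?C z \<inter> {x. l + t \<le> p x})"
      using in_l \<eta>(3)[OF l \<open>0 < t\<close> t(2)] by (simp add: componentsI)
    also have "\<dots> \<le> ereal (dist y z)"
      unfolding set_distance_def using in_l yz(1,2)
      by (intro INF_lower2[of y] INF_lower2[of z]) auto
    finally have "c\<^sub>S * t powr (1 / \<alpha>) \<le> dist y z" by simp
    moreover have "t powr (1 / \<alpha>) = 4 * h / c\<^sub>S"
      unfolding t(1) using assms(1) h \<eta>(1) by (simp add: powr_powr)
    ultimately show ?thesis using \<eta>(1) by simp
  qed
  then show ?thesis using \<eta>(2) by blast
qed

lemma prob_at_least_imp:
  assumes "prob_at_least M q P" "q' \<le> q" "\<And>\<omega>. P \<omega> \<Longrightarrow> Q \<omega>"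
  shows "prob_at_least M q' Q"
  using assms unfolding prob_at_least_def by (meson order_trans)

lemma accurate_mono:
  assumes "accurate M X p n T \<delta> \<gamma>" "\<gamma> \<le> \<gamma>'"
  shows "accurate M X p n T \<delta> \<gamma>'"
  using assms unfolding accurate_def by (auto intro: prob_at_least_imp)

lemma prob_at_least_satisfiable:
  assumes "prob_at_least M q Q" "0 < q"
  obtains \<omega> where "Q \<omega>"
  using assms unfolding prob_at_least_def
  by (metis all_not_in_conv measure_empty not_le)

text \<open>
  Accuracy for a fixed sample size. The bound on the failure probability adds that for the density
  estimate and that for the sample missing some ball of radius \<open>h / 4\<close> of the covers.
\<close>

lemma dbscan_accurate:
  fixes p :: "'a::euclidean_space \<Rightarrow> real"
  defines "d \<equiv> DIM('a)" and "V \<equiv> measure lebesgue (cball (0::'a) 1)"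
  assumes p: "prob_density p" "continuous_on UNIV p" "compact_connected_support p"
    and iid: "iid_from_density M X p"
    and \<Lambda>: "finite {l. split_level p l}" "0 < u" "\<And>l. split_level p l \<Longrightarrow> u \<le> l"
    and est: "prob_at_least M (1 - \<gamma>) (\<lambda>\<omega>. sup_norm (\<lambda>y. kde K h n (\<lambda>i. X i \<omega>) y - p y) \<le> ereal a)"
    and "\<gamma> < 1" "0 < h" "h / 4 \<le> r\<^sub>I" "0 < t" "2 * a + t \<le> \<delta>" "2 * a + t \<le> \<delta>\<^sub>0"
    and gap: "\<And>l y z. split_level p l \<Longrightarrow> l + t \<le> p y \<Longrightarrow> l + t \<le> p z \<Longrightarrow>
      \<not> connected_component {x. l < p x} y z \<Longrightarrow> 2 * h \<le> dist y z"
    and C: "\<And>l \<epsilon>. split_level p l \<Longrightarrow> 0 < \<epsilon> \<Longrightarrow> \<epsilon> \<le> \<delta>\<^sub>0 \<Longrightarrow>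
      inner_regular_set r\<^sub>I c\<^sub>I {x. l + \<epsilon> \<le> p x} \<and> coverable_set r\<^sub>I C\<^sub>I {x. l + \<epsilon> \<le> p x}"
  shows "accurate M X p n (dbscan K h n) \<delta>
    (\<gamma> + real (card {l. split_level p l}) * (C\<^sub>I * (h / 4) powr (- real d)) *
         exp (- (real n * (u * (c\<^sub>I * V * (h / 4) ^ d)))))"
proof -
  have "prob_space M" using iid unfolding iid_from_density_def by simp
  have abs_le: "\<bar>f y\<bar> \<le> a" if "sup_norm f \<le> ereal a" for f :: "'a \<Rightarrow> real" and y
    using that unfolding sup_norm_def by (simp add: SUP_le_iff)
  (* The event of the estimate has positive probability, so it occurs for some outcome. *)
  have "0 \<le> a"
    using est \<open>\<gamma> < 1\<close> abs_le by (elim prob_at_least_satisfiable) (auto, smt (verit))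
  define \<epsilon> where "\<epsilon> = 2 * a + t"
  have \<epsilon>: "0 < \<epsilon>" "\<epsilon> \<le> \<delta>\<^sub>0"
    unfolding \<epsilon>_def using \<open>0 \<le> a\<close> \<open>0 < t\<close> \<open>2 * a + t \<le> \<delta>\<^sub>0\<close> by auto
  have dense: "prob_at_least M
      (1 - real (card {l. split_level p l}) * (C\<^sub>I * (h / 4) powr (- real d)) *
         exp (- (real n * (u * (c\<^sub>I * V * (h / 4) ^ d)))))
      (\<lambda>\<omega>. \<forall>l\<in>{l. split_level p l}. \<forall>y. l + \<epsilon> \<le> p y \<longrightarrow>
         (\<exists>i<n. l + \<epsilon> \<le> p (X i \<omega>) \<and> dist y (X i \<omega>) \<le> 2 * (h / 4)))"
    unfolding d_def V_def
    using p(1) \<Lambda> \<epsilon> \<open>0 < h\<close> \<open>h / 4 \<le> r\<^sub>I\<close> C unfolding prob_density_def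
    by (intro prob_sample_dense_in_superlevel_sets[OF iid]) auto
  have "prob_at_least M (1 - (\<gamma> + real (card {l. split_level p l}) * (C\<^sub>I * (h / 4) powr (- real d)) *
         exp (- (real n * (u * (c\<^sub>I * V * (h / 4) ^ d)))))) (\<lambda>\<omega>.
       let x = (\<lambda>i. X i \<omega>); S = sample_points n x in
       \<forall>A A'. A \<subseteq> density_support p \<and> A' \<subseteq> density_support p \<and> connected A \<and> connected A' \<and>
         delta_separated p \<delta> A A' \<longrightarrow>
         (A \<inter> S = {} \<or> A' \<inter> S = {}) \<noteq>
           smallest_clusters_disjoint (dbscan K h n x) (A \<inter> S) (A' \<inter> S))"
  proof (rule prob_at_least_imp[OF prob_at_least_conj[OF \<open>prob_space M\<close> est dense] order_refl],
      unfold Let_def, intro allI impI, elim conjE)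
    fix \<omega> A A'
    assume sup: "sup_norm (\<lambda>y. kde K h n (\<lambda>i. X i \<omega>) y - p y) \<le> ereal a"
      and dense: "\<forall>l\<in>{l. split_level p l}. \<forall>y. l + \<epsilon> \<le> p y \<longrightarrow>
         (\<exists>i<n. l + \<epsilon> \<le> p (X i \<omega>) \<and> dist y (X i \<omega>) \<le> 2 * (h / 4))"
      and A: "connected A" "connected A'" "delta_separated p \<delta> A A'"
    show "(A \<inter> sample_points n (\<lambda>i. X i \<omega>) = {} \<or> A' \<inter> sample_points n (\<lambda>i. X i \<omega>) = {}) \<noteq>
      smallest_clusters_disjoint (dbscan K h n (\<lambda>i. X i \<omega>))
        (A \<inter> sample_points n (\<lambda>i. X i \<omega>)) (A' \<inter> sample_points n (\<lambda>i. X i \<omega>))"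
    proof (rule dbscan_resolves_separated_sets[OF p(2,3) _ \<open>0 < h\<close> \<open>0 < t\<close> _ gap _
          \<open>2 * a + t \<le> \<delta>\<close> A])
      show "0 \<le> p y" for y using p(1) unfolding prob_density_def by simp
      show "\<bar>kde K h n (\<lambda>i. X i \<omega>) y - p y\<bar> \<le> a" for y using abs_le[OF sup] .
      show "\<exists>i<n. l + (2 * a + t) \<le> p (X i \<omega>) \<and> dist y (X i \<omega>) \<le> h / 2"
        if "split_level p l" "l + (2 * a + t) \<le> p y" for l y
        using dense that unfolding \<epsilon>_def by auto
    qed
  qed
  then show ?thesis
    unfolding accurate_def using cluster_tree_dbscan by blast
qed

theorem theorem1:
  fixes p :: "'a::euclidean_space \<Rightarrow> real"
  assumes "prob_density p"
    and "compact_connected_support p"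
    and "finite {l. split_level p l}"
    and "condition_C p"
  shows "\<exists>c>0. \<forall>\<alpha> L c\<^sub>S K h C\<^sub>1 C\<^sub>2 \<delta> (M :: 'w measure) X.
    1 < \<alpha> \<longrightarrow> 0 < L \<longrightarrow> p \<in> hoelder_class L \<alpha> \<longrightarrow> condition_S p \<alpha> c\<^sub>S \<longrightarrow>
    valid_kernel \<alpha> K \<longrightarrow> bounded (range K) \<longrightarrow> bounded {x. K x \<noteq> 0} \<longrightarrow> vc_kernel K \<longrightarrow>
    (\<forall>n. 0 < h n) \<longrightarrow>
    h \<in> \<Theta>(\<lambda>n. (ln (real n) / real n) powr (1 / (2 * \<alpha> + real DIM('a)))) \<longrightarrow>
    iid_from_density M X p \<longrightarrow>
    kde_constants M X p K h \<alpha> C\<^sub>1 C\<^sub>2 \<longrightarrow>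
    (\<forall>n. 0 < \<delta> n) \<longrightarrow> \<delta> \<longlonglongrightarrow> 0 \<longrightarrow>
    (\<forall>\<^sub>F n in sequentially.
       2 * kde_bound DIM('a) \<alpha> C\<^sub>1 C\<^sub>2 n (h n) (ln (real n)) + (4 * h n / c\<^sub>S) powr \<alpha> \<le> \<delta> n) \<longrightarrow>
    (\<exists>r \<in> O(\<lambda>n. h n powr (- real DIM('a)) *
               exp (- c * real n powr (\<alpha> / (2 * \<alpha> + real DIM('a))))).
       delta_consistent M X p (\<lambda>n x. dbscan K (h n) n x) \<delta> (\<lambda>n. 1 / real n + r n))"
proof -
  define d where "d = DIM('a)"
  define V where "V = measure lebesgue (cball (0::'a) 1)"
  define \<Lambda> where "\<Lambda> = {l. split_level p l}"
  have "0 < V" unfolding V_def by (simp add: content_cball_pos)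
  obtain \<delta>\<^sub>0 r\<^sub>I c\<^sub>I C\<^sub>I where C: "0 < \<delta>\<^sub>0" "0 < r\<^sub>I" "0 < c\<^sub>I" "0 < C\<^sub>I"
    "\<And>l \<epsilon>. split_level p l \<Longrightarrow> 0 < \<epsilon> \<Longrightarrow> \<epsilon> \<le> \<delta>\<^sub>0 \<Longrightarrow>
      inner_regular_set r\<^sub>I c\<^sub>I {x. l + \<epsilon> \<le> p x} \<and> coverable_set r\<^sub>I C\<^sub>I {x. l + \<epsilon> \<le> p x}"
    using assms(4) unfolding condition_C_def by metis
  (* The element 1 only serves to make the minimum defined if there are no split levels. *)
  define u where "u = Min (insert 1 \<Lambda>)"
  have "finite \<Lambda>" unfolding \<Lambda>_def by fact
  then have u: "0 < u" "\<And>l. split_level p l \<Longrightarrow> u \<le> l"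
    unfolding u_def by (auto simp: \<Lambda>_def split_level_def)
  define \<kappa> where "\<kappa> = u * (c\<^sub>I * V) / 4 ^ d"
  have "0 < \<kappa>" unfolding \<kappa>_def using u(1) C(3) \<open>0 < V\<close> by simp
  define B where "B = real (card \<Lambda>) * C\<^sub>I * 4 ^ d"
  have "0 \<le> B" unfolding B_def using C(4) by simp
  show ?thesis
  proof (intro exI[of _ 1] conjI allI impI)
    fix \<alpha> L c\<^sub>S :: real and K :: "'a \<Rightarrow> real" and h :: "nat \<Rightarrow> real" and C\<^sub>1 C\<^sub>2 :: real
      and \<delta> :: "nat \<Rightarrow> real" and M :: "'w measure" and X :: "nat \<Rightarrow> 'w \<Rightarrow> 'a"
    assume \<alpha>: "1 < \<alpha>" and hoelder: "p \<in> hoelder_class L \<alpha>" and S: "condition_S p \<alpha> c\<^sub>S"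
      and h: "\<forall>n. 0 < h n" "h \<in> \<Theta>(\<lambda>n. (ln (real n) / real n) powr (1 / (2 * \<alpha> + real DIM('a))))"
      and iid: "iid_from_density M X p" and kde: "kde_constants M X p K h \<alpha> C\<^sub>1 C\<^sub>2"
      and \<delta>: "\<forall>n. 0 < \<delta> n" "\<delta> \<longlonglongrightarrow> 0"
      and rate: "\<forall>\<^sub>F n in sequentially.
        2 * kde_bound DIM('a) \<alpha> C\<^sub>1 C\<^sub>2 n (h n) (ln (real n)) + (4 * h n / c\<^sub>S) powr \<alpha> \<le> \<delta> n"
    define \<beta> where "\<beta> = \<alpha> / (2 * \<alpha> + real d)"
    define D where "D = 2 * \<alpha> + real d"
    have "0 < D" "0 < \<beta>" unfolding D_def \<beta>_def using \<alpha> by (auto intro: divide_pos_pos)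
    have D: "1 - real d / D = 2 * \<beta>"
      using \<open>0 < D\<close> unfolding \<beta>_def D_def by (simp add: field_simps)
    have cont: "continuous_on UNIV p" using hoelder by (rule hoelder_class_continuous)
    have "0 < c\<^sub>S" using S unfolding condition_S_def by simp
    obtain \<eta> where \<eta>: "0 < \<eta>"
      "\<And>h l y z. 0 < h \<Longrightarrow> (4 * h / c\<^sub>S) powr \<alpha> \<le> \<eta> \<Longrightarrow> split_level p l \<Longrightarrow>
        l + (4 * h / c\<^sub>S) powr \<alpha> \<le> p y \<Longrightarrow> l + (4 * h / c\<^sub>S) powr \<alpha> \<le> p z \<Longrightarrow>
        \<not> connected_component {x. l < p x} y z \<Longrightarrow> 4 * h \<le> dist y z"
      using condition_S_gap[OF \<alpha> S] by metis
    have h_lim: "h \<longlonglongrightarrow> 0"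
      using h(2) \<open>0 < D\<close> unfolding D_def d_def by (intro bandwidth_tendsto_0)
    have "(\<lambda>n. (4 * h n / c\<^sub>S) powr \<alpha>) \<longlonglongrightarrow> (4 * 0 / c\<^sub>S) powr \<alpha>"
      using h_lim \<alpha> h(1) \<open>0 < c\<^sub>S\<close>
      by (intro tendsto_powr' tendsto_intros) (auto intro!: always_eventually less_imp_le)
    then have t_lim: "(\<lambda>n. (4 * h n / c\<^sub>S) powr \<alpha>) \<longlonglongrightarrow> 0" using \<alpha> by simp
    obtain c where c: "0 < c" "\<forall>\<^sub>F n in sequentially. c * real n powr (2 * \<beta>) \<le> real n * h n ^ d"
      using bandwidth_volume_ge[of D h d] h \<open>0 < D\<close> D unfolding D_def d_def by auto
    define r where "r n = B * (h n powr (- real d) * exp (- (real n powr \<beta>)))" for n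

    have acc: "\<forall>\<^sub>F n in sequentially. accurate M X p n (dbscan K (h n) n) (\<delta> n) (1 / real n + r n)"
      using eventually_ge_at_top[of 2] c(2) rate kde[unfolded kde_constants_def]
        powr_eventually_dominates[of "c * \<kappa>" \<beta> 1, OF mult_pos_pos[OF c(1) \<open>0 < \<kappa>\<close>] \<open>0 < \<beta>\<close>]
        powr_eventually_dominates[of c \<beta> 1, OF c(1) \<open>0 < \<beta>\<close>]
        order_tendstoD(2)[OF h_lim, of "4 * r\<^sub>I", OF mult_pos_pos[OF zero_less_numeral C(2)]]
        order_tendstoD(2)[OF t_lim \<eta>(1)] order_tendstoD(2)[OF \<delta>(2) C(1)]
    proof eventually_elim
      case (elim n)
      define t where "t = (4 * h n / c\<^sub>S) powr \<alpha>"
      define a where "a = kde_bound DIM('a) \<alpha> C\<^sub>1 C\<^sub>2 n (h n) (ln (real n))"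
      have "0 < h n" using h(1) by simp
      then have "0 < t" unfolding t_def using \<open>0 < c\<^sub>S\<close> by simp
      have "1 \<le> real n powr \<beta>" using elim(1) \<open>0 < \<beta>\<close> by (intro ge_one_powr_ge_zero) auto
      then have "1 \<le> real n * h n ^ DIM('a)" using elim(2,6) unfolding d_def by linarith
      moreover have "0 < ln (real n)" using elim(1) by simp
      ultimately have "prob_at_least M (1 - exp (- ln (real n)))
          (\<lambda>\<omega>. sup_norm (\<lambda>y. kde K (h n) n (\<lambda>i. X i \<omega>) y - p y) \<le> ereal a)"
        using elim(4) unfolding a_def by blast
      moreover have "exp (- ln (real n)) = 1 / real n"
        using elim(1) by (simp add: exp_minus inverse_eq_divide)
      ultimately have est: "prob_at_least M (1 - 1 / real n)
          (\<lambda>\<omega>. sup_norm (\<lambda>y. kde K (h n) n (\<lambda>i. X i \<omega>) y - p y) \<le> ereal a)"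
        by simp
      have gap: "2 * h n \<le> dist y z"
        if "split_level p l" "l + t \<le> p y" "l + t \<le> p z" "\<not> connected_component {x. l < p x} y z"
        for l y z
        using \<eta>(2)[OF \<open>0 < h n\<close> _ that[unfolded t_def]] elim(8) \<open>0 < h n\<close> by simp
      have "accurate M X p n (dbscan K (h n) n) (\<delta> n)
        (1 / real n + real (card {l. split_level p l}) * (C\<^sub>I * (h n / 4) powr (- real DIM('a))) *
         exp (- (real n * (u * (c\<^sub>I * measure lebesgue (cball (0::'a) 1) * (h n / 4) ^ DIM('a))))))"
      proof (rule dbscan_accurate[OF assms(1) cont assms(2) iid assms(3) u est])
        show "1 / real n < 1" using elim(1) by simp
        show "h n / 4 \<le> r\<^sub>I" using elim(7) by simp
        show "2 * a + t \<le> \<delta> n" using elim(3) unfolding a_def t_def .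
        then show "2 * a + t \<le> \<delta>\<^sub>0" using elim(9) by simp
      qed (use \<open>0 < h n\<close> \<open>0 < t\<close> gap C(5) in blast)+
      moreover have "real (card {l. split_level p l}) * (C\<^sub>I * (h n / 4) powr (- real DIM('a))) *
         exp (- (real n * (u * (c\<^sub>I * measure lebesgue (cball (0::'a) 1) * (h n / 4) ^ DIM('a))))) \<le> r n"
      proof -
        have "(h n / 4) powr (- real d) = 4 ^ d * h n powr (- real d)"
          using \<open>0 < h n\<close> by (simp add: powr_minus_divide powr_realpow power_divide)
        then have pre: "real (card \<Lambda>) * (C\<^sub>I * (h n / 4) powr (- real d)) = B * h n powr (- real d)"
          unfolding B_def by simp
        have "real n powr \<beta> \<le> \<kappa> * (c * real n powr (2 * \<beta>))" using elim(5) by (simp add: mult_ac)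
        also have "\<dots> \<le> \<kappa> * (real n * h n ^ d)"
          using elim(2) \<open>0 < \<kappa>\<close> by (intro mult_left_mono) auto
        also have "\<dots> = real n * (u * (c\<^sub>I * V * (h n / 4) ^ d))"
          unfolding \<kappa>_def by (simp add: power_divide)
        finally have "exp (- (real n * (u * (c\<^sub>I * V * (h n / 4) ^ d)))) \<le> exp (- (real n powr \<beta>))"
          by simp
        then have "B * h n powr (- real d) * exp (- (real n * (u * (c\<^sub>I * V * (h n / 4) ^ d))))
            \<le> B * h n powr (- real d) * exp (- (real n powr \<beta>))"
          using \<open>0 \<le> B\<close> by (intro mult_left_mono) auto
        then show ?thesis
          unfolding pre[unfolded d_def \<Lambda>_def] r_def d_def V_def by (simp add: mult.assoc)
      qed
      ultimately show ?case by (elim accurate_mono) simp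
    qed

    have "r \<in> O(\<lambda>n. real n * exp (- (real n powr \<beta>)))"
    proof (rule bigoI[where c = "B / c"])
      show "\<forall>\<^sub>F n in sequentially. norm (r n) \<le> B / c * norm (real n * exp (- (real n powr \<beta>)))"
        using c(2) eventually_ge_at_top[of 1]
      proof eventually_elim
        case (elim n)
        have "0 < h n" using h(1) by simp
        have "1 \<le> real n powr (2 * \<beta>)" using elim(2) \<open>0 < \<beta>\<close> by (intro ge_one_powr_ge_zero) auto
        then have "c * 1 \<le> c * real n powr (2 * \<beta>)"
          using c(1) by (intro mult_left_mono) auto
        then have "c \<le> real n * h n ^ d" using elim(1) by linarith
        then have "h n powr (- real d) \<le> real n / c"
          using \<open>0 < h n\<close> c(1) by (simp add: powr_minus powr_realpow field_simps)
        then have "h n powr (- real d) * exp (- (real n powr \<beta>)) \<le> real n / c * exp (- (real n powr \<beta>))"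
          by (intro mult_right_mono) auto
        then have "B * (h n powr (- real d) * exp (- (real n powr \<beta>))) \<le>
            B * (real n / c * exp (- (real n powr \<beta>)))"
          using \<open>0 \<le> B\<close> by (rule mult_left_mono)
        then show ?case unfolding r_def using \<open>0 \<le> B\<close> by (simp add: abs_mult)
      qed
    qed
    also have "(\<lambda>n. real n * exp (- (real n powr \<beta>))) \<in> O(\<lambda>n. real n powr - 1)"
      using \<open>0 < \<beta>\<close> by (rule exp_neg_powr_bigo)
    finally have "r \<in> O(\<lambda>n. real n powr - 1)" .
    moreover have "(\<lambda>n. 1 / real n) \<in> O(\<lambda>n. real n powr - 1)" by real_asymp
    ultimately have poly: "(\<lambda>n. 1 / real n + r n) \<in> O(\<lambda>n. real n powr - 1)"
      by (rule sum_in_bigo(1)[rotated])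
    have "(\<lambda>n. 1 / real n + r n) \<longlonglongrightarrow> 0"
      using poly by (rule bigo_tendsto_0) real_asymp
    then have "delta_consistent M X p (\<lambda>n x. dbscan K (h n) n x) \<delta> (\<lambda>n. 1 / real n + r n)"
      unfolding delta_consistent_def using \<delta> acc poly by (auto intro!: exI[of _ 1])
    moreover have "r \<in> O(\<lambda>n. h n powr (- real DIM('a)) *
        exp (- 1 * real n powr (\<alpha> / (2 * \<alpha> + real DIM('a)))))"
      unfolding r_def \<beta>_def d_def using \<open>0 \<le> B\<close> by (intro bigoI[where c = B]) (simp add: abs_mult)
    ultimately show "\<exists>r \<in> O(\<lambda>n. h n powr (- real DIM('a)) *
        exp (- 1 * real n powr (\<alpha> / (2 * \<alpha> + real DIM('a))))).
        delta_consistent M X p (\<lambda>n x. dbscan K (h n) n x) \<delta> (\<lambda>n. 1 / real n + r n)"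
      by blast
  qed simp
qed

end
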